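(* The functor $\Phi\colon \mathbf{Grp}^{\mathrm{op}}\to \mathbf{Comonads}(\mathbf{Set})$, $G\mapsto K_G$, is faithful.
   Context: For a group $G$, the comonad $K_G=(K_G,\epsilon^G,\delta^G)$ on $\mathbf{Set}$ is given by: $K_G(X)=X^G$, the set of all functions $G\to X$; $K_G(f)(\phi)=f\circ\phi$ for a map $f\colon X\to Y$; counit $\epsilon^G_X\colon X^G\to X$, $\epsilon^G_X(\phi)=\phi(e_G)$; comultiplication $\delta^G_X\colon X^G\to (X^G)^G$, $\delta^G_X(\phi)(g)(h)=\phi(gh)$. A morphism of comonads $(K,\epsilon,\delta)\to(K',\epsilon',\delta')$ on a category is a natural transformation $\phi\colon K\Rightarrow K'$ with $\epsilon'\circ\phi=\epsilon$ and $\delta'\circ\phi=(\phi\phi)\circ\delta$, where $\phi\phi\colon K^2\Rightarrow K'^2$ is the horizontal composite. $\mathbf{Comonads}(\mathbf{Set})$ is the category of comonads on $\mathbf{Set}$ and morphisms of comonads. The functor $\Phi$ sends $G$ to $K_G$ and a group morphism $f\colon G\to H$ to the comonad morphism $\Phi(f)\colon K_H\Rightarrow K_G$ with components $\Phi(f)_X(\alpha)=\alpha\circ f$ for $\alpha\in X^H$. *)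

theory Defs
  imports "HOL-Algebra.Group" "HOL-Library.Nat_Bijection"
begin

text \<open>
  Hom-sets are indexed by objects and need not be disjoint, so composition takes the three
  objects as arguments: \<open>Cmp C X Y Z g f\<close> is the composite of \<open>f : X \<rightarrow> Y\<close> and \<open>g : Y \<rightarrow> Z\<close>.
\<close>

record ('o, 'a) cat =
  Obj :: "'o set"
  Hom :: "'o \<Rightarrow> 'o \<Rightarrow> 'a set"
  Idn :: "'o \<Rightarrow> 'a"
  Cmp :: "'o \<Rightarrow> 'o \<Rightarrow> 'o \<Rightarrow> 'a \<Rightarrow> 'a \<Rightarrow> 'a"

definition category :: "('o, 'a) cat \<Rightarrow> bool" where
  "category C \<longleftrightarrow>
     (\<forall>X\<in>Obj C. Idn C X \<in> Hom C X X) \<and>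
     (\<forall>X\<in>Obj C. \<forall>Y\<in>Obj C. \<forall>Z\<in>Obj C. \<forall>f\<in>Hom C X Y. \<forall>g\<in>Hom C Y Z.
        Cmp C X Y Z g f \<in> Hom C X Z) \<and>
     (\<forall>X\<in>Obj C. \<forall>Y\<in>Obj C. \<forall>f\<in>Hom C X Y.
        Cmp C X X Y f (Idn C X) = f \<and> Cmp C X Y Y (Idn C Y) f = f) \<and>
     (\<forall>W\<in>Obj C. \<forall>X\<in>Obj C. \<forall>Y\<in>Obj C. \<forall>Z\<in>Obj C.
        \<forall>f\<in>Hom C W X. \<forall>g\<in>Hom C X Y. \<forall>h\<in>Hom C Y Z.
        Cmp C W X Z (Cmp C X Y Z h g) f = Cmp C W Y Z h (Cmp C W X Y g f))"

definition op_cat :: "('o, 'a) cat \<Rightarrow> ('o, 'a) cat" where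
  "op_cat C = \<lparr>Obj = Obj C, Hom = (\<lambda>X Y. Hom C Y X), Idn = Idn C,
               Cmp = (\<lambda>X Y Z g f. Cmp C Z Y X f g)\<rparr>"

record ('o, 'a, 'p, 'b) cfunctor =
  omap :: "'o \<Rightarrow> 'p"
  amap :: "'o \<Rightarrow> 'o \<Rightarrow> 'a \<Rightarrow> 'b"

definition is_functor :: "('o, 'a) cat \<Rightarrow> ('p, 'b) cat \<Rightarrow> ('o, 'a, 'p, 'b) cfunctor \<Rightarrow> bool" where
  "is_functor C D F \<longleftrightarrow>
     category C \<and> category D \<and>
     (\<forall>X\<in>Obj C. omap F X \<in> Obj D) \<and>
     (\<forall>X\<in>Obj C. \<forall>Y\<in>Obj C. \<forall>f\<in>Hom C X Y. amap F X Y f \<in> Hom D (omap F X) (omap F Y)) \<and>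
     (\<forall>X\<in>Obj C. amap F X X (Idn C X) = Idn D (omap F X)) \<and>
     (\<forall>X\<in>Obj C. \<forall>Y\<in>Obj C. \<forall>Z\<in>Obj C. \<forall>f\<in>Hom C X Y. \<forall>g\<in>Hom C Y Z.
        amap F X Z (Cmp C X Y Z g f) =
        Cmp D (omap F X) (omap F Y) (omap F Z) (amap F Y Z g) (amap F X Y f))"

definition faithful_functor ::
  "('o, 'a) cat \<Rightarrow> ('p, 'b) cat \<Rightarrow> ('o, 'a, 'p, 'b) cfunctor \<Rightarrow> bool" where
  "faithful_functor C D F \<longleftrightarrow>
     is_functor C D F \<and> (\<forall>X\<in>Obj C. \<forall>Y\<in>Obj C. inj_on (amap F X Y) (Hom C X Y))"

definition id_functor :: "('o, 'a, 'o, 'a) cfunctor" where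
  "id_functor = \<lparr>omap = (\<lambda>X. X), amap = (\<lambda>X Y f. f)\<rparr>"

definition comp_functor ::
  "('p, 'b, 'q, 'c) cfunctor \<Rightarrow> ('o, 'a, 'p, 'b) cfunctor \<Rightarrow> ('o, 'a, 'q, 'c) cfunctor" where
  "comp_functor G F = \<lparr>omap = (\<lambda>X. omap G (omap F X)),
                       amap = (\<lambda>X Y f. amap G (omap F X) (omap F Y) (amap F X Y f))\<rparr>"

text \<open>
  A transformation is a family of arrows indexed by the objects of the source category, so its
  values elsewhere are fixed by \<^const>\<open>extensional\<close>.
\<close>

definition nat_trans ::
  "('o, 'a) cat \<Rightarrow> ('p, 'b) cat \<Rightarrow> ('o, 'a, 'p, 'b) cfunctor \<Rightarrow> ('o, 'a, 'p, 'b) cfunctor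
    \<Rightarrow> ('o \<Rightarrow> 'b) \<Rightarrow> bool" where
  "nat_trans C D F G \<phi> \<longleftrightarrow>
     \<phi> \<in> extensional (Obj C) \<and>
     (\<forall>X\<in>Obj C. \<phi> X \<in> Hom D (omap F X) (omap G X)) \<and>
     (\<forall>X\<in>Obj C. \<forall>Y\<in>Obj C. \<forall>f\<in>Hom C X Y.
        Cmp D (omap F X) (omap G X) (omap G Y) (amap G X Y f) (\<phi> X) =
        Cmp D (omap F X) (omap F Y) (omap G Y) (\<phi> Y) (amap F X Y f))"

definition vcomp ::
  "('o, 'a) cat \<Rightarrow> ('p, 'b) cat \<Rightarrow> ('o, 'a, 'p, 'b) cfunctor \<Rightarrow> ('o, 'a, 'p, 'b) cfunctor
    \<Rightarrow> ('o, 'a, 'p, 'b) cfunctor \<Rightarrow> ('o \<Rightarrow> 'b) \<Rightarrow> ('o \<Rightarrow> 'b) \<Rightarrow> ('o \<Rightarrow> 'b)" where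
  "vcomp C D F G H \<psi> \<phi> = (\<lambda>X\<in>Obj C. Cmp D (omap F X) (omap G X) (omap H X) (\<psi> X) (\<phi> X))"

text \<open>\<open>hcomp C E F F' G G' \<beta> \<alpha>\<close> is the horizontal composite of \<open>\<alpha> : F \<Rightarrow> F'\<close> and
  \<open>\<beta> : G \<Rightarrow> G'\<close>, where \<open>C\<close> is the source of \<open>F\<close>, \<open>F'\<close> and \<open>E\<close> the target of \<open>G\<close>, \<open>G'\<close>.\<close>

definition hcomp ::
  "('o, 'a) cat \<Rightarrow> ('q, 'c) cat
    \<Rightarrow> ('o, 'a, 'p, 'b) cfunctor \<Rightarrow> ('o, 'a, 'p, 'b) cfunctor
    \<Rightarrow> ('p, 'b, 'q, 'c) cfunctor \<Rightarrow> ('p, 'b, 'q, 'c) cfunctor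
    \<Rightarrow> ('p \<Rightarrow> 'c) \<Rightarrow> ('o \<Rightarrow> 'b) \<Rightarrow> ('o \<Rightarrow> 'c)" where
  "hcomp C E F F' G G' \<beta> \<alpha> =
     (\<lambda>X\<in>Obj C. Cmp E (omap G (omap F X)) (omap G (omap F' X)) (omap G' (omap F' X))
                     (\<beta> (omap F' X)) (amap G (omap F X) (omap F' X) (\<alpha> X)))"

record ('o, 'a) comonad =
  endo :: "('o, 'a, 'o, 'a) cfunctor"
  counit :: "'o \<Rightarrow> 'a"
  comult :: "'o \<Rightarrow> 'a"

definition is_comonad :: "('o, 'a) cat \<Rightarrow> ('o, 'a) comonad \<Rightarrow> bool" where
  "is_comonad C K \<longleftrightarrow>
     (let T = endo K; T0 = omap T; T1 = amap T; \<epsilon> = counit K; \<delta> = comult K in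
      is_functor C C T \<and>
      nat_trans C C T id_functor \<epsilon> \<and>
      nat_trans C C T (comp_functor T T) \<delta> \<and>
      (\<forall>X\<in>Obj C.
         Cmp C (T0 X) (T0 (T0 X)) (T0 X) (\<epsilon> (T0 X)) (\<delta> X) = Idn C (T0 X) \<and>
         Cmp C (T0 X) (T0 (T0 X)) (T0 X) (T1 (T0 X) X (\<epsilon> X)) (\<delta> X) = Idn C (T0 X) \<and>
         Cmp C (T0 X) (T0 (T0 X)) (T0 (T0 (T0 X))) (\<delta> (T0 X)) (\<delta> X) =
         Cmp C (T0 X) (T0 (T0 X)) (T0 (T0 (T0 X))) (T1 (T0 X) (T0 (T0 X)) (\<delta> X)) (\<delta> X)))"

definition comonad_mor ::
  "('o, 'a) cat \<Rightarrow> ('o, 'a) comonad \<Rightarrow> ('o, 'a) comonad \<Rightarrow> ('o \<Rightarrow> 'a) \<Rightarrow> bool" where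
  "comonad_mor C K K' \<phi> \<longleftrightarrow>
     (let T = endo K; T' = endo K' in
      nat_trans C C T T' \<phi> \<and>
      vcomp C C T T' id_functor (counit K') \<phi> = counit K \<and>
      vcomp C C T T' (comp_functor T' T') (comult K') \<phi> =
      vcomp C C T (comp_functor T T) (comp_functor T' T') (hcomp C C T T' T T' \<phi> \<phi>) (comult K))"

text \<open>
  Hom-sets are exact.  Values of \<^const>\<open>omap\<close> and \<^const>\<open>amap\<close> off the objects and arrows are not
  normalised, so a comonad may occur as several objects, isomorphic by identities; likewise for
  values of a group operation off the carrier in the category of groups.
\<close>

definition Comonads :: "('o, 'a) cat \<Rightarrow> (('o, 'a) comonad, 'o \<Rightarrow> 'a) cat" where
  "Comonads C =
     \<lparr>Obj = {K. is_comonad C K},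
      Hom = (\<lambda>K K'. {\<phi>. comonad_mor C K K' \<phi>}),
      Idn = (\<lambda>K. \<lambda>X\<in>Obj C. Idn C (omap (endo K) X)),
      Cmp = (\<lambda>K K' K'' \<psi> \<phi>. vcomp C C (endo K) (endo K') (endo K'') \<psi> \<phi>)\<rparr>"

text \<open>
  In HOL, \<open>X\<close> and \<open>X\<^sup>G\<close> live in different types, so sets over a fixed HOL type do not directly
  carry the endofunctor \<open>X \<mapsto> X\<^sup>G\<close>.  The category of sets is therefore taken relative to an
  arbitrary Grothendieck universe: a type whose elements are themselves sets, satisfying the
  second-order ZF axioms other than infinity, which is not part of Grothendieck's definition of a
  universe.  What is proved for every type of this class holds in particular for universes with
  infinite sets; without infinity the axioms are satisfiable in HOL, as the instance below shows.
\<close>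

class grothendieck_universe =
  fixes elts :: "'a \<Rightarrow> 'a set"
  assumes extensionality: "elts x = elts y \<Longrightarrow> x = y"
    and foundation: "wf {(x, y). x \<in> elts y}"
    and pairing: "\<exists>z. elts z = {x, y}"
    and union: "\<exists>z. elts z = (\<Union>y\<in>elts x. elts y)"
    and powerset: "\<exists>z. elts z = {y. elts y \<subseteq> elts x}"
    and replacement: "\<exists>z. elts z = f ` elts x"

text \<open>The hereditarily finite sets, in Ackermann's coding.\<close>

instantiation nat :: grothendieck_universe
begin

definition elts_nat :: "nat \<Rightarrow> nat set" where
  "elts_nat = set_decode"

instance
proof
  have ex: "\<exists>z::nat. elts z = A" if "finite A" for A
    using that by (metis elts_nat_def set_encode_inverse)
  have fin: "finite (elts n)" for n :: nat
    by (simp add: elts_nat_def)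
  show "x = y" if "elts x = elts y" for x y :: nat
    using that by (metis elts_nat_def set_decode_inverse)
  show "wf {(x::nat, y). x \<in> elts y}"
  proof (rule wf_subset[OF wf_less_than])
    have "x < y" if "x \<in> set_decode y" for x y
    proof -
      have "2 ^ x \<le> y"
        using that by (metis div_less even_zero linorder_not_le set_decode_def mem_Collect_eq)
      then show ?thesis
        using less_exp[of x] by (meson less_le_trans)
    qed
    then show "{(x::nat, y). x \<in> elts y} \<subseteq> less_than"
      by (auto simp: elts_nat_def)
  qed
  show "\<exists>z. elts z = {x, y}" for x y :: nat
    by (rule ex) simp
  show "\<exists>z. elts z = (\<Union>y\<in>elts x. elts y)" for x :: nat
    by (rule ex) (simp add: fin)
  show "\<exists>z. elts z = {y. elts y \<subseteq> elts x}" for x :: nat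
  proof (rule ex)
    have "{y. elts y \<subseteq> elts x} \<subseteq> set_encode ` Pow (elts x)"
      by (auto simp: elts_nat_def) (metis PowI image_eqI set_decode_inverse)
    then show "finite {y. elts y \<subseteq> elts x}"
      by (meson fin finite_Pow_iff finite_imageI finite_subset)
  qed
  show "\<exists>z. elts z = f ` elts x" for x :: nat and f :: "nat \<Rightarrow> nat"
    by (rule ex) (simp add: fin)
qed

end

definition small :: "'v::grothendieck_universe set \<Rightarrow> bool" where
  "small A \<longleftrightarrow> A \<in> range elts"

text \<open>Meaningful for small arguments only.\<close>

definition vset :: "'v::grothendieck_universe set \<Rightarrow> 'v" where
  "vset A = (THE x. elts x = A)"

definition vpair :: "'v::grothendieck_universe \<Rightarrow> 'v \<Rightarrow> 'v" where
  "vpair x y = vset {vset {x}, vset {x, y}}"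

text \<open>
  A function on a small set \<open>A\<close> becomes an element of the universe as its graph; \<open>app\<close> evaluates
  such a graph, and \<open>vexp X A\<close> is the set \<open>X\<^sup>A\<close> of all functions from \<open>A\<close> to \<open>X\<close>.
\<close>

definition graph :: "'v::grothendieck_universe set \<Rightarrow> ('v \<Rightarrow> 'v) \<Rightarrow> 'v" where
  "graph A f = vset ((\<lambda>a. vpair a (f a)) ` A)"

definition app :: "'v::grothendieck_universe \<Rightarrow> 'v \<Rightarrow> 'v" where
  "app \<phi> a = (THE b. vpair a b \<in> elts \<phi>)"

definition vexp :: "'v::grothendieck_universe \<Rightarrow> 'v set \<Rightarrow> 'v" where
  "vexp X A = vset (graph A ` (A \<rightarrow> elts X))"

definition Set_cat :: "('v::grothendieck_universe, 'v \<Rightarrow> 'v) cat" where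
  "Set_cat = \<lparr>Obj = UNIV,
              Hom = (\<lambda>X Y. elts X \<rightarrow>\<^sub>E elts Y),
              Idn = (\<lambda>X. \<lambda>x\<in>elts X. x),
              Cmp = (\<lambda>X Y Z g f. compose (elts X) g f)\<rparr>"

definition Grp_cat :: "('v::grothendieck_universe monoid, 'v \<Rightarrow> 'v) cat" where
  "Grp_cat = \<lparr>Obj = {G. group G \<and> small (carrier G)},
              Hom = (\<lambda>G H. hom G H \<inter> extensional (carrier G)),
              Idn = (\<lambda>G. \<lambda>x\<in>carrier G. x),
              Cmp = (\<lambda>G H L g f. compose (carrier G) g f)\<rparr>"

definition K_comonad :: "'v::grothendieck_universe monoid \<Rightarrow> ('v, 'v \<Rightarrow> 'v) comonad" where
  "K_comonad G =
     \<lparr>endo = \<lparr>omap = (\<lambda>X. vexp X (carrier G)),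
              amap = (\<lambda>X Y f. \<lambda>\<phi>\<in>elts (vexp X (carrier G)).
                        graph (carrier G) (\<lambda>g. f (app \<phi> g)))\<rparr>,
      counit = (\<lambda>X. \<lambda>\<phi>\<in>elts (vexp X (carrier G)). app \<phi> \<one>\<^bsub>G\<^esub>),
      comult = (\<lambda>X. \<lambda>\<phi>\<in>elts (vexp X (carrier G)).
                  graph (carrier G) (\<lambda>g. graph (carrier G) (\<lambda>h. app \<phi> (g \<otimes>\<^bsub>G\<^esub> h))))\<rparr>"

text \<open>An arrow from \<open>H\<close> to \<open>G\<close> in the opposite category is a group morphism \<open>f : G \<rightarrow> H\<close>.\<close>

definition Phi ::
  "('v::grothendieck_universe monoid, 'v \<Rightarrow> 'v, ('v, 'v \<Rightarrow> 'v) comonad, 'v \<Rightarrow> 'v \<Rightarrow> 'v) cfunctor" where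
  "Phi = \<lparr>omap = K_comonad,
          amap = (\<lambda>H G f. \<lambda>X. \<lambda>\<alpha>\<in>elts (vexp X (carrier H)).
                    graph (carrier G) (\<lambda>g. app \<alpha> (f g)))\<rparr>"

end

theory Submission
  imports Defs
begin

text \<open>
  A morphism \<open>f : G \<rightarrow> H\<close> is recovered from \<open>\<Phi>(f)\<close> by evaluating the component at the carrier of
  \<open>H\<close> on the identity function of that carrier.
\<close>

section \<open>Small sets and functions in a Grothendieck universe\<close>

lemma small_elts [simp]: "small (elts x)"
  by (simp add: small_def)

text \<open>Smallness gives a code for \<open>A\<close> and \<open>extensionality\<close> makes it
  unique, so the definite description in \<open>vset\<close> denotes it.\<close>

lemma elts_vset [simp]:
  assumes "small A"
  shows "elts (vset A) = A"
proof -
  obtain x where "elts x = A"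
    using assms by (auto simp: small_def)
  then show ?thesis
    unfolding vset_def by (metis (mono_tags, lifting) extensionality theI')
qed

lemma vset_inject: "small A \<Longrightarrow> small B \<Longrightarrow> vset A = vset B \<longleftrightarrow> A = B"
  by (metis elts_vset)

lemma small_empty [simp]: "small ({} :: 'v::grothendieck_universe set)"
proof -
  \<comment> \<open>A membership-minimal element of the whole universe can have no elements, so
    foundation alone yields the empty set.\<close>
  obtain x :: 'v where "\<forall>y. (y, x) \<in> {(x, y). x \<in> elts y} \<longrightarrow> y \<notin> UNIV"
    using foundation[unfolded wf_eq_minimal] by (metis UNIV_I)
  then have "elts x = {}"
    by auto
  then show ?thesis
    by (metis small_elts)
qed

lemma small_image:
  fixes f :: "'v::grothendieck_universe \<Rightarrow> 'v"
  shows "small A \<Longrightarrow> small (f ` A)"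
  using replacement[of f "vset A"] by (auto simp: small_def)

text \<open>Separation follows from replacement. The replacement axiom speaks of total functions
  only, hence the separate case of an empty subset.\<close>

lemma small_subset:
  assumes "small B" "A \<subseteq> B"
  shows "small A"
proof (cases "A = {}")
  case False
  then obtain a where "a \<in> A"
    by blast
  \<comment> \<open>The map is a retraction of \<open>B\<close> onto \<open>A\<close>: everything
    outside \<open>A\<close> is sent to the chosen \<open>a\<close>.\<close>
  then have "A = (\<lambda>x. if x \<in> A then x else a) ` B"
    using assms(2) by auto
  then show ?thesis
    using small_image[OF assms(1)] by metis
qed simp

lemma small_insert2 [simp]: "small {x, y}"
  using pairing[of x y] by (metis small_elts)

lemma small_singleton [simp]: "small {x}"
  using small_insert2[of x x] by simp

lemma small_Un:
  assumes "small A" "small B"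
  shows "small (A \<union> B)"
proof -
  obtain z where "elts z = (\<Union>y\<in>elts (vset {vset A, vset B}). elts y)"
    using union by blast
  then have "elts z = A \<union> B"
    using assms by simp
  then show ?thesis
    by (metis small_elts)
qed

lemma small_Pow:
  assumes "small A"
  shows "small {y. elts y \<subseteq> A}"
  using powerset[of "vset A"] assms by (metis elts_vset small_elts)

section \<open>Ordered pairs, graphs and exponentials\<close>

lemma vpair_inject [simp]: "vpair a b = vpair c d \<longleftrightarrow> a = c \<and> b = d"
  by (auto simp: vpair_def vset_inject doubleton_eq_iff)

lemma elts_graph: "small A \<Longrightarrow> elts (graph A f) = (\<lambda>a. vpair a (f a)) ` A"
  by (simp add: graph_def small_image)

text \<open>The beta rule. The described value is unique because the first component of a pair
  determines the point of \<open>A\<close>.\<close>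

lemma app_graph [simp]:
  assumes "small A" "a \<in> A"
  shows "app (graph A f) a = f a"
  using assms by (auto simp: app_def elts_graph)

lemma graph_eq_iff:
  assumes "small A"
  shows "graph A f = graph A g \<longleftrightarrow> (\<forall>a\<in>A. f a = g a)"
proof
  show "\<forall>a\<in>A. f a = g a" if "graph A f = graph A g"
    using that app_graph[OF assms] by metis
  show "graph A f = graph A g" if "\<forall>a\<in>A. f a = g a"
    using that by (simp add: graph_def cong: image_cong)
qed

text \<open>A Kuratowski pair is a set of subsets of \<open>A \<union> B\<close>, so a graph is a
  set of sets of such subsets. All graphs therefore lie in a threefold iterated power set, which is
  small.\<close>

lemma small_graphs:
  assumes "small A" "small B"
  shows "small (graph A ` (A \<rightarrow> B))"
proof (rule small_subset)
  show "small {w. elts w \<subseteq> {p. elts p \<subseteq> {s. elts s \<subseteq> A \<union> B}}}"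
    using assms by (intro small_Pow small_Un)
  show "graph A ` (A \<rightarrow> B) \<subseteq> {w. elts w \<subseteq> {p. elts p \<subseteq> {s. elts s \<subseteq> A \<union> B}}}"
  proof clarify
    fix f a s
    assume f: "f \<in> A \<rightarrow> B" and "a \<in> elts (graph A f)" "s \<in> elts a"
    then obtain x where x: "x \<in> A" and "s = vset {x} \<or> s = vset {x, f x}"
      using assms(1) by (auto simp: elts_graph vpair_def)
    then have "elts s \<subseteq> {x, f x}"
      by auto
    \<comment> \<open>\<open>clarify\<close> has split membership in the union, leaving the case
      outside \<open>B\<close>; the only other candidate is the point \<open>x\<close> of
      \<open>A\<close>.\<close>
    then show "y \<in> A" if "y \<in> elts s" "y \<notin> B" for y
      using that f x by auto
  qed
qed

lemma elts_vexp: "small A \<Longrightarrow> elts (vexp X A) = graph A ` (A \<rightarrow> elts X)"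
  by (simp add: vexp_def small_graphs)

lemma graph_in_vexp [simp]:
  assumes "small A"
  shows "graph A f \<in> elts (vexp X A) \<longleftrightarrow> (\<forall>a\<in>A. f a \<in> elts X)"
  using assms by (auto simp: elts_vexp graph_eq_iff Pi_iff)

lemma vexp_cases:
  assumes "\<phi> \<in> elts (vexp X A)" "small A"
  obtains f where "\<phi> = graph A f" "\<And>a. a \<in> A \<Longrightarrow> f a \<in> elts X"
  using assms by (auto simp: elts_vexp)

lemma app_in [simp]:
  assumes "\<phi> \<in> elts (vexp X A)" "small A" "a \<in> A"
  shows "app \<phi> a \<in> elts X"
  using assms by (auto elim: vexp_cases)

lemma graph_app:
  assumes "\<phi> \<in> elts (vexp X A)" "small A"
  shows "graph A (app \<phi>) = \<phi>"
  using assms by (auto elim!: vexp_cases simp: graph_eq_iff)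

text \<open>The eta rule \<open>graph_app\<close> as a pointwise criterion. It serves the laws in
  which one side is an arbitrary element of an exponential, such as identity and counit laws, where
  \<open>graph_eq_iff\<close> does not match.\<close>

lemma graph_eq_vexp_iff:
  assumes "\<phi> \<in> elts (vexp X A)" "small A"
  shows "graph A f = \<phi> \<longleftrightarrow> (\<forall>a\<in>A. f a = app \<phi> a)"
  using assms graph_app graph_eq_iff by metis

section \<open>The category of comonads\<close>

text \<open>The axioms as separate conditional rewrite rules. Since \<open>Cmp\<close> names its
  three objects, every reassociation must discharge object and hom-set premises.\<close>

lemma
  assumes "category C"
  shows category_Idn: "X \<in> Obj C \<Longrightarrow> Idn C X \<in> Hom C X X"
    and category_Cmp: "\<lbrakk>X \<in> Obj C; Y \<in> Obj C; Z \<in> Obj C; f \<in> Hom C X Y; g \<in> Hom C Y Z\<rbrakk>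
      \<Longrightarrow> Cmp C X Y Z g f \<in> Hom C X Z"
    and category_Idn_right: "\<lbrakk>X \<in> Obj C; Y \<in> Obj C; f \<in> Hom C X Y\<rbrakk> \<Longrightarrow> Cmp C X X Y f (Idn C X) = f"
    and category_Idn_left: "\<lbrakk>X \<in> Obj C; Y \<in> Obj C; f \<in> Hom C X Y\<rbrakk> \<Longrightarrow> Cmp C X Y Y (Idn C Y) f = f"
    and category_assoc: "\<lbrakk>W \<in> Obj C; X \<in> Obj C; Y \<in> Obj C; Z \<in> Obj C;
        f \<in> Hom C W X; g \<in> Hom C X Y; h \<in> Hom C Y Z\<rbrakk>
      \<Longrightarrow> Cmp C W X Z (Cmp C X Y Z h g) f = Cmp C W Y Z h (Cmp C W X Y g f)"
  using assms unfolding category_def by blast+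

lemma
  assumes "is_functor C D F"
  shows functor_omap: "X \<in> Obj C \<Longrightarrow> omap F X \<in> Obj D"
    and functor_amap: "\<lbrakk>X \<in> Obj C; Y \<in> Obj C; f \<in> Hom C X Y\<rbrakk>
      \<Longrightarrow> amap F X Y f \<in> Hom D (omap F X) (omap F Y)"
    and functor_Idn: "X \<in> Obj C \<Longrightarrow> amap F X X (Idn C X) = Idn D (omap F X)"
    and functor_Cmp: "\<lbrakk>X \<in> Obj C; Y \<in> Obj C; Z \<in> Obj C; f \<in> Hom C X Y; g \<in> Hom C Y Z\<rbrakk>
      \<Longrightarrow> amap F X Z (Cmp C X Y Z g f) =
        Cmp D (omap F X) (omap F Y) (omap F Z) (amap F Y Z g) (amap F X Y f)"
  using assms unfolding is_functor_def by blast+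

lemma
  assumes "nat_trans C D F G \<phi>"
  shows nat_trans_extensional: "\<phi> \<in> extensional (Obj C)"
    and nat_trans_Hom: "X \<in> Obj C \<Longrightarrow> \<phi> X \<in> Hom D (omap F X) (omap G X)"
    and nat_trans_natural: "\<lbrakk>X \<in> Obj C; Y \<in> Obj C; f \<in> Hom C X Y\<rbrakk>
      \<Longrightarrow> Cmp D (omap F X) (omap G X) (omap G Y) (amap G X Y f) (\<phi> X) =
        Cmp D (omap F X) (omap F Y) (omap G Y) (\<phi> Y) (amap F X Y f)"
  using assms unfolding nat_trans_def by blast+

lemma nat_trans_Idn:
  assumes "is_functor C D F"
  shows "nat_trans C D F F (\<lambda>X\<in>Obj C. Idn D (omap F X))"
proof -
  have D: "category D"
    using assms by (simp add: is_functor_def)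
  show ?thesis
    unfolding nat_trans_def
    by (simp add: category_Idn[OF D] category_Idn_left[OF D] category_Idn_right[OF D]
        functor_omap[OF assms] functor_amap[OF assms])
qed

text \<open>Two naturality squares are pasted: the arrow \<open>f\<close> is moved first past
  \<psi>, then past \<phi>, with associativity regrouping the composite in between.\<close>

lemma nat_trans_vcomp:
  assumes F: "is_functor C D F" and G: "is_functor C D G" and H: "is_functor C D H"
    and \<phi>: "nat_trans C D F G \<phi>" and \<psi>: "nat_trans C D G H \<psi>"
  shows "nat_trans C D F H (vcomp C D F G H \<psi> \<phi>)"
proof -
  have D: "category D"
    using F by (simp add: is_functor_def)
  note Hom = nat_trans_Hom[OF \<phi>] nat_trans_Hom[OF \<psi>]
    functor_omap[OF F] functor_omap[OF G] functor_omap[OF H]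
    functor_amap[OF F] functor_amap[OF G] functor_amap[OF H]
  have "Cmp D (omap F X) (omap H X) (omap H Y) (amap H X Y f)
          (Cmp D (omap F X) (omap G X) (omap H X) (\<psi> X) (\<phi> X)) =
        Cmp D (omap F X) (omap F Y) (omap H Y)
          (Cmp D (omap F Y) (omap G Y) (omap H Y) (\<psi> Y) (\<phi> Y)) (amap F X Y f)"
    (is "?l = ?r") if XY: "X \<in> Obj C" "Y \<in> Obj C" and f: "f \<in> Hom C X Y" for X Y f
  proof -
    have "?l = Cmp D (omap F X) (omap G X) (omap H Y)
        (Cmp D (omap G X) (omap H X) (omap H Y) (amap H X Y f) (\<psi> X)) (\<phi> X)"
      using XY f by (simp add: Hom category_assoc[OF D])
    also have "\<dots> = Cmp D (omap F X) (omap G X) (omap H Y)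
        (Cmp D (omap G X) (omap G Y) (omap H Y) (\<psi> Y) (amap G X Y f)) (\<phi> X)"
      using XY f by (simp add: nat_trans_natural[OF \<psi>])
    also have "\<dots> = Cmp D (omap F X) (omap G Y) (omap H Y) (\<psi> Y)
        (Cmp D (omap F X) (omap G X) (omap G Y) (amap G X Y f) (\<phi> X))"
      using XY f by (simp add: Hom category_assoc[OF D])
    also have "\<dots> = Cmp D (omap F X) (omap G Y) (omap H Y) (\<psi> Y)
        (Cmp D (omap F X) (omap F Y) (omap G Y) (\<phi> Y) (amap F X Y f))"
      using XY f by (simp add: nat_trans_natural[OF \<phi>])
    also have "\<dots> = ?r"
      using XY f by (simp add: Hom category_assoc[OF D])
    finally show ?thesis .
  qed
  then show ?thesis
    unfolding nat_trans_def vcomp_def by (simp add: category_Cmp[OF D] Hom)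
qed

section \<open>Comonads, their morphisms and the category they form\<close>

lemma
  assumes "is_comonad C K"
  shows comonad_functor: "is_functor C C (endo K)"
    and comonad_counit: "nat_trans C C (endo K) id_functor (counit K)"
    and comonad_comult: "nat_trans C C (endo K) (comp_functor (endo K) (endo K)) (comult K)"
  using assms by (simp_all add: is_comonad_def Let_def)

lemma comonad_mor_iff:
  "comonad_mor C K K' \<phi> \<longleftrightarrow>
     nat_trans C C (endo K) (endo K') \<phi> \<and>
     vcomp C C (endo K) (endo K') id_functor (counit K') \<phi> = counit K \<and>
     vcomp C C (endo K) (endo K') (comp_functor (endo K') (endo K')) (comult K') \<phi> =
     vcomp C C (endo K) (comp_functor (endo K) (endo K)) (comp_functor (endo K') (endo K'))
       (hcomp C C (endo K) (endo K') (endo K) (endo K') \<phi> \<phi>) (comult K)"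
  by (simp add: comonad_mor_def Let_def)

lemma extensional_restrict_eq_iff:
  "f \<in> extensional A \<Longrightarrow> restrict g A = f \<longleftrightarrow> (\<forall>x\<in>A. g x = f x)"
  by (auto simp: fun_eq_iff extensional_def)

lemma restrict_eq_restrict_iff: "restrict f A = restrict g A \<longleftrightarrow> (\<forall>x\<in>A. f x = g x)"
  by (auto simp: fun_eq_iff)

text \<open>Equality of families reduces to equality at each object because every family compared is
  extensional: each \<open>vcomp\<close> is a restriction, and for \<open>counit K\<close> this is
  part of \<open>K\<close> being a comonad.\<close>

lemma comonad_mor_pointwise:
  assumes K: "is_comonad C K"
  shows "comonad_mor C K K' \<phi> \<longleftrightarrow>
     nat_trans C C (endo K) (endo K') \<phi> \<and>
     (\<forall>X\<in>Obj C. let T = omap (endo K); T' = omap (endo K') in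
        Cmp C (T X) (T' X) X (counit K' X) (\<phi> X) = counit K X \<and>
        Cmp C (T X) (T' X) (T' (T' X)) (comult K' X) (\<phi> X) =
        Cmp C (T X) (T (T X)) (T' (T' X))
          (Cmp C (T (T X)) (T (T' X)) (T' (T' X)) (\<phi> (T' X)) (amap (endo K) (T X) (T' X) (\<phi> X)))
          (comult K X))"
proof -
  have ext: "counit K \<in> extensional (Obj C)"
    using nat_trans_extensional[OF comonad_counit[OF K]] .
  show ?thesis
    unfolding comonad_mor_iff vcomp_def hcomp_def
    by (simp add: extensional_restrict_eq_iff[OF ext] restrict_eq_restrict_iff
        id_functor_def comp_functor_def Let_def) blast
qed

text \<open>The endofunctor preserves identities, so the horizontal square of the identity
  transformation is again an identity.\<close>

lemma comonad_mor_Idn: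
  assumes K: "is_comonad C K"
  shows "comonad_mor C K K (\<lambda>X\<in>Obj C. Idn C (omap (endo K) X))"
proof -
  note T = comonad_functor[OF K]
  then have C: "category C"
    by (simp add: is_functor_def)
  have counit: "counit K X \<in> Hom C (omap (endo K) X) X" if "X \<in> Obj C" for X
    using nat_trans_Hom[OF comonad_counit[OF K] that] by (simp add: id_functor_def)
  have comult: "comult K X \<in> Hom C (omap (endo K) X) (omap (endo K) (omap (endo K) X))"
    if "X \<in> Obj C" for X
    using nat_trans_Hom[OF comonad_comult[OF K] that] by (simp add: comp_functor_def)
  show ?thesis
    unfolding comonad_mor_pointwise[OF K] Let_def
    by (simp add: nat_trans_Idn[OF T] functor_omap[OF T] functor_Idn[OF T] counit comult
        category_Idn[OF C] category_Idn_left[OF C] category_Idn_right[OF C])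
qed

text \<open>Counits compose by associativity. For comultiplications the point is the interchange
  law: the horizontal square of \<psi> after that of \<phi> is the horizontal square of the vertical
  composite.\<close>

lemma comonad_mor_vcomp:
  assumes K: "is_comonad C K" and K': "is_comonad C K'" and K'': "is_comonad C K''"
    and \<phi>: "comonad_mor C K K' \<phi>" and \<psi>: "comonad_mor C K' K'' \<psi>"
  shows "comonad_mor C K K'' (vcomp C C (endo K) (endo K') (endo K'') \<psi> \<phi>)"
proof -
  note F = comonad_functor[OF K] comonad_functor[OF K'] comonad_functor[OF K'']
  have C: "category C"
    using F(1) by (simp add: is_functor_def)
  have nat: "nat_trans C C (endo K) (endo K') \<phi>" "nat_trans C C (endo K') (endo K'') \<psi>"
    using \<phi> \<psi> by (simp_all add: comonad_mor_iff)
  define T T' T'' where "T = omap (endo K)" and "T' = omap (endo K')" and "T'' = omap (endo K'')"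
  define M M' where "M = amap (endo K)" and "M' = amap (endo K')"
  have Obj: "T X \<in> Obj C" "T' X \<in> Obj C" "T'' X \<in> Obj C" if "X \<in> Obj C" for X
    using functor_omap[OF F(1) that] functor_omap[OF F(2) that] functor_omap[OF F(3) that]
    by (simp_all add: T_def T'_def T''_def)
  have Hom: "\<phi> X \<in> Hom C (T X) (T' X)" "\<psi> X \<in> Hom C (T' X) (T'' X)"
    "counit K'' X \<in> Hom C (T'' X) X"
    "comult K X \<in> Hom C (T X) (T (T X))"
    "comult K' X \<in> Hom C (T' X) (T' (T' X))"
    "comult K'' X \<in> Hom C (T'' X) (T'' (T'' X))"
    if "X \<in> Obj C" for X
    using that nat_trans_Hom[OF nat(1)] nat_trans_Hom[OF nat(2)]
      nat_trans_Hom[OF comonad_counit[OF K'']] nat_trans_Hom[OF comonad_comult[OF K]]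
      nat_trans_Hom[OF comonad_comult[OF K']] nat_trans_Hom[OF comonad_comult[OF K'']]
    by (simp_all add: T_def T'_def T''_def id_functor_def comp_functor_def)
  have amap: "M X Y f \<in> Hom C (T X) (T Y)" "M' X Y f \<in> Hom C (T' X) (T' Y)"
    if "X \<in> Obj C" "Y \<in> Obj C" "f \<in> Hom C X Y" for X Y f
    using functor_amap[OF F(1)] functor_amap[OF F(2)] that
    by (simp_all add: T_def T'_def M_def M'_def)
  have natural: "Cmp C (T X) (T' X) (T' Y) (M' X Y f) (\<phi> X) = Cmp C (T X) (T Y) (T' Y) (\<phi> Y) (M X Y f)"
    if "X \<in> Obj C" "Y \<in> Obj C" "f \<in> Hom C X Y" for X Y f
    using nat_trans_natural[OF nat(1)] that by (simp add: T_def T'_def M_def M'_def)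
  have M_Cmp: "M X Z (Cmp C X Y Z g f) = Cmp C (T X) (T Y) (T Z) (M Y Z g) (M X Y f)"
    if "X \<in> Obj C" "Y \<in> Obj C" "Z \<in> Obj C" "f \<in> Hom C X Y" "g \<in> Hom C Y Z" for X Y Z f g
    using functor_Cmp[OF F(1)] that by (simp add: T_def M_def)
  have \<phi>_counit: "Cmp C (T X) (T' X) X (counit K' X) (\<phi> X) = counit K X"
    and \<phi>_comult: "Cmp C (T X) (T' X) (T' (T' X)) (comult K' X) (\<phi> X) =
        Cmp C (T X) (T (T X)) (T' (T' X))
          (Cmp C (T (T X)) (T (T' X)) (T' (T' X)) (\<phi> (T' X)) (M (T X) (T' X) (\<phi> X))) (comult K X)"
    and \<psi>_counit: "Cmp C (T' X) (T'' X) X (counit K'' X) (\<psi> X) = counit K' X"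
    and \<psi>_comult: "Cmp C (T' X) (T'' X) (T'' (T'' X)) (comult K'' X) (\<psi> X) =
        Cmp C (T' X) (T' (T' X)) (T'' (T'' X))
          (Cmp C (T' (T' X)) (T' (T'' X)) (T'' (T'' X)) (\<psi> (T'' X)) (M' (T' X) (T'' X) (\<psi> X))) (comult K' X)"
    if "X \<in> Obj C" for X
    using \<phi> \<psi> that
    by (simp_all add: comonad_mor_pointwise[OF K] comonad_mor_pointwise[OF K'] Let_def
        T_def T'_def T''_def M_def M'_def)
  note simps = Obj Hom amap category_Cmp[OF C] category_assoc[OF C]
  have counit: "Cmp C (T X) (T'' X) X (counit K'' X) (Cmp C (T X) (T' X) (T'' X) (\<psi> X) (\<phi> X)) = counit K X"
    if X: "X \<in> Obj C" for X
  proof -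
    have "Cmp C (T X) (T'' X) X (counit K'' X) (Cmp C (T X) (T' X) (T'' X) (\<psi> X) (\<phi> X)) =
      Cmp C (T X) (T' X) X (Cmp C (T' X) (T'' X) X (counit K'' X) (\<psi> X)) (\<phi> X)"
      using X by (simp add: simps)
    then show ?thesis
      using X by (simp add: \<phi>_counit \<psi>_counit)
  qed
  have comult: "Cmp C (T X) (T'' X) (T'' (T'' X)) (comult K'' X) (Cmp C (T X) (T' X) (T'' X) (\<psi> X) (\<phi> X)) =
      Cmp C (T X) (T (T X)) (T'' (T'' X))
        (Cmp C (T (T X)) (T (T'' X)) (T'' (T'' X))
          (Cmp C (T (T'' X)) (T' (T'' X)) (T'' (T'' X)) (\<psi> (T'' X)) (\<phi> (T'' X)))
          (M (T X) (T'' X) (Cmp C (T X) (T' X) (T'' X) (\<psi> X) (\<phi> X))))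
        (comult K X)" (is "?l = ?r")
    if X: "X \<in> Obj C" for X
  proof -
    have "?l = Cmp C (T X) (T' X) (T'' (T'' X))
        (Cmp C (T' X) (T'' X) (T'' (T'' X)) (comult K'' X) (\<psi> X)) (\<phi> X)"
      using X by (simp add: simps)
    also have "\<dots> = Cmp C (T X) (T' (T' X)) (T'' (T'' X))
          (Cmp C (T' (T' X)) (T' (T'' X)) (T'' (T'' X)) (\<psi> (T'' X)) (M' (T' X) (T'' X) (\<psi> X)))
          (Cmp C (T X) (T' X) (T' (T' X)) (comult K' X) (\<phi> X))"
      unfolding \<psi>_comult[OF X] using X by (simp add: simps)
    \<comment> \<open>The regrouping puts \<open>M'\<close> of \<open>\<psi> X\<close> directly
      after \<open>\<phi> (T' X)\<close>, which is one side of the naturality square of \<phi> at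
      the arrow \<open>\<psi> X\<close>.\<close>
    also have "\<dots> = Cmp C (T X) (T (T X)) (T'' (T'' X))
        (Cmp C (T (T X)) (T (T' X)) (T'' (T'' X))
          (Cmp C (T (T' X)) (T' (T'' X)) (T'' (T'' X)) (\<psi> (T'' X))
            (Cmp C (T (T' X)) (T' (T' X)) (T' (T'' X)) (M' (T' X) (T'' X) (\<psi> X)) (\<phi> (T' X))))
          (M (T X) (T' X) (\<phi> X)))
        (comult K X)"
      unfolding \<phi>_comult[OF X] using X by (simp add: simps)
    \<comment> \<open>Naturality turns that pair into \<open>\<phi> (T'' X)\<close> after
      \<open>M\<close> of \<open>\<psi> X\<close>; functoriality of \<open>M\<close> splits the
      composite arrow on the right to match.\<close>
    also have "\<dots> = ?r"
      using X by (simp add: simps natural M_Cmp)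
    finally show ?thesis .
  qed
  show ?thesis
    unfolding comonad_mor_pointwise[OF K] Let_def
    using nat_trans_vcomp[OF F nat] counit comult
    by (simp add: vcomp_def Obj flip: T_def T'_def T''_def M_def)
qed

text \<open>The laws of \<open>C\<close> are applied componentwise. Extensionality of
  transformations turns the unit laws into equalities of families, not merely of their values on
  objects.\<close>

lemma category_Comonads:
  assumes C: "category C"
  shows "category (Comonads C)"
proof -
  have nat: "nat_trans C C (endo K) (endo L) \<phi>" if "comonad_mor C K L \<phi>" for K L \<phi>
    using that by (simp add: comonad_mor_iff)
  have idn: "vcomp C C (endo K) (endo K) (endo L) \<phi> (\<lambda>X\<in>Obj C. Idn C (omap (endo K) X)) = \<phi>"
    "vcomp C C (endo K) (endo L) (endo L) (\<lambda>X\<in>Obj C. Idn C (omap (endo L) X)) \<phi> = \<phi>"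
    if K: "is_comonad C K" and L: "is_comonad C L" and \<phi>: "comonad_mor C K L \<phi>" for K L \<phi>
    unfolding vcomp_def extensional_restrict_eq_iff[OF nat_trans_extensional[OF nat[OF \<phi>]]]
    by (simp_all add: category_Idn_left[OF C] category_Idn_right[OF C] nat_trans_Hom[OF nat[OF \<phi>]]
        functor_omap[OF comonad_functor[OF K]] functor_omap[OF comonad_functor[OF L]])
  have assoc: "vcomp C C (endo J) (endo K) (endo M) (vcomp C C (endo K) (endo L) (endo M) h g) f =
      vcomp C C (endo J) (endo L) (endo M) h (vcomp C C (endo J) (endo K) (endo L) g f)"
    if "is_comonad C J" "is_comonad C K" "is_comonad C L" "is_comonad C M"
      and f: "comonad_mor C J K f" and g: "comonad_mor C K L g" and h: "comonad_mor C L M h"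
    for J K L M f g h
    unfolding vcomp_def restrict_eq_restrict_iff
    using that(1-4)[THEN comonad_functor, THEN functor_omap]
      nat_trans_Hom[OF nat[OF f]] nat_trans_Hom[OF nat[OF g]] nat_trans_Hom[OF nat[OF h]]
    by (simp add: category_assoc[OF C])
  show ?thesis
    unfolding category_def Comonads_def
    by (simp add: comonad_mor_Idn comonad_mor_vcomp idn assoc)
qed

section \<open>Groups and the comonads they define\<close>

lemma category_op_cat: "category C \<Longrightarrow> category (op_cat C)"
  unfolding category_def op_cat_def by simp

lemma category_Set_cat: "category Set_cat"
  unfolding category_def Set_cat_def
  by (auto simp: PiE_def Id_compose compose_Id compose_assoc[symmetric] compose_eq
      dest: funcset_mem)

text \<open>\<open>compose\<close> is meaningful only on the carrier, so preservation of products
  needs closure of the multiplication of \<open>G\<close>.\<close>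

lemma compose_in_hom:
  assumes "group G" "f \<in> hom G H" "g \<in> hom H L"
  shows "compose (carrier G) g f \<in> hom G L"
  using assms by (simp add: hom_def compose_eq Pi_iff group.is_monoid monoid.m_closed)

lemma category_Grp_cat: "category Grp_cat"
proof -
  have "(\<lambda>x\<in>carrier G. x) \<in> hom G G" if "group G" for G :: "'a monoid"
    using that by (simp add: hom_def group.is_monoid monoid.m_closed)
  moreover have Pi: "f \<in> carrier G \<rightarrow> carrier H" if "f \<in> hom G H" for f and G H :: "'a monoid"
    using that by (simp add: hom_def)
  ultimately show ?thesis
    unfolding category_def Grp_cat_def
    by (auto simp: Id_compose compose_assoc[OF Pi] intro: compose_Id[OF Pi] compose_in_hom)
qed

section \<open>The comonad of a group and its dependence on the group\<close>

text \<open>Evaluated at group elements, the two counit laws are the left and right unit laws of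
  \<open>G\<close>, and coassociativity is associativity of its multiplication.\<close>

lemma is_comonad_K_comonad:
  assumes "group G" and small: "small (carrier G)"
  shows "is_comonad Set_cat (K_comonad G)"
proof -
  interpret group G by fact
  note simps = Set_cat_def K_comonad_def comp_functor_def id_functor_def small compose_def
    PiE_iff graph_eq_iff restrict_eq_restrict_iff m_assoc
  have endo: "is_functor Set_cat Set_cat (endo (K_comonad G))"
    unfolding is_functor_def using category_Set_cat
    by (auto simp: simps graph_eq_vexp_iff[OF _ small])
  have counit: "nat_trans Set_cat Set_cat (endo (K_comonad G)) id_functor (counit (K_comonad G))"
    unfolding nat_trans_def by (auto simp: simps)
  have comult: "nat_trans Set_cat Set_cat (endo (K_comonad G))
      (comp_functor (endo (K_comonad G)) (endo (K_comonad G))) (comult (K_comonad G))"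
    unfolding nat_trans_def by (auto simp: simps)
  show ?thesis
    unfolding is_comonad_def Let_def using endo counit comult
    by (auto simp: simps graph_eq_vexp_iff[OF _ small])
qed

text \<open>Naturality holds because precomposition with \<open>f\<close> commutes with
  postcomposition. Compatibility with counits is preservation of the unit by \<open>f\<close>, and
  compatibility with comultiplications is preservation of products.\<close>

lemma comonad_mor_Phi:
  assumes G: "group G" "small (carrier G)" and H: "group H" "small (carrier H)"
    and f: "f \<in> hom G H"
  shows "comonad_mor Set_cat (K_comonad H) (K_comonad G) (amap Phi H G f)"
proof -
  interpret group_hom G H f
    using G(1) H(1) f by (simp add: group_hom_def group_hom_axioms_def)
  note simps = Set_cat_def K_comonad_def Phi_def G(2) H(2) compose_def PiE_iff graph_eq_iff
    restrict_eq_restrict_iff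
  show ?thesis
    unfolding comonad_mor_pointwise[OF is_comonad_K_comonad[OF H]] nat_trans_def Let_def
    by (auto simp: simps)
qed

lemma omap_Phi: "omap Phi = K_comonad"
  by (simp add: Phi_def)

lemma is_functor_Phi:
  "is_functor (op_cat Grp_cat) (Comonads Set_cat)
     (Phi :: ('v::grothendieck_universe monoid, 'v \<Rightarrow> 'v,
              ('v, 'v \<Rightarrow> 'v) comonad, 'v \<Rightarrow> 'v \<Rightarrow> 'v) cfunctor)"
proof -
  have "amap Phi G G (\<lambda>x\<in>carrier G. x) = Idn (Comonads Set_cat) (K_comonad G)"
    if "small (carrier G)" for G :: "'v monoid"
    using that
    by (auto simp: Phi_def Comonads_def Set_cat_def K_comonad_def restrict_eq_restrict_iff
        graph_eq_vexp_iff[OF _ that])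
  \<comment> \<open>Precomposition reverses order: restricting along \<open>g\<close> and then along
    \<open>f\<close> is restricting along the composite, which matches composition in
    \<open>op_cat Grp_cat\<close>.\<close>
  moreover have "amap Phi L G (compose (carrier G) g f) =
      Cmp (Comonads Set_cat) (K_comonad L) (K_comonad H) (K_comonad G)
        (amap Phi H G f) (amap Phi L H g)"
    if "small (carrier G)" "small (carrier H)" "small (carrier L)" "f \<in> hom G H" "g \<in> hom H L"
    for G H L :: "'v monoid" and f g
    using that
    by (auto simp: Phi_def Comonads_def Set_cat_def K_comonad_def vcomp_def compose_def hom_def
        Pi_iff graph_eq_iff restrict_eq_restrict_iff)
  moreover have "K_comonad G \<in> Obj (Comonads Set_cat)"
    if "group G" "small (carrier G)" for G :: "'v monoid"
    using is_comonad_K_comonad[OF that] by (simp add: Comonads_def)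
  moreover have "amap Phi H G f \<in> Hom (Comonads Set_cat) (K_comonad H) (K_comonad G)"
    if "group G" "small (carrier G)" "group H" "small (carrier H)" "f \<in> hom G H"
    for G H :: "'v monoid" and f
    using comonad_mor_Phi[OF that] by (simp add: Comonads_def)
  ultimately show ?thesis
    unfolding is_functor_def
    by (intro conjI category_op_cat category_Grp_cat category_Comonads category_Set_cat)
      (simp_all add: op_cat_def Grp_cat_def omap_Phi)
qed

section \<open>Recovering a homomorphism from its comonad morphism\<close>

lemma Phi_amap_inject:
  assumes small: "small (carrier G)" "small (carrier H)"
    and f: "f \<in> hom G H" and f': "f' \<in> hom G H"
    and eq: "amap Phi H G f = amap Phi H G f'" and x: "x \<in> carrier G"
  shows "f x = f' x"
proof -
  \<comment> \<open>Smallness makes the carrier of \<open>H\<close> an object of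
    \<open>Set_cat\<close>, and \<open>?i\<close> codes its identity function as an element of the
    exponential at that object.\<close>
  let ?i = "graph (carrier H) (\<lambda>h. h)"
  have i: "?i \<in> elts (vexp (vset (carrier H)) (carrier H))"
    using small by simp
  have "graph (carrier G) (\<lambda>g. app ?i (f g)) = graph (carrier G) (\<lambda>g. app ?i (f' g))"
    \<comment> \<open>The inner \<open>fun_cong\<close> selects the component at the carrier, the
      outer one evaluates it at \<open>?i\<close>; by \<open>i\<close> the restriction does not
      return its default value.\<close>
    using fun_cong[OF fun_cong[OF eq], of "vset (carrier H)" ?i] i by (simp add: Phi_def)
  then have "app ?i (f x) = app ?i (f' x)"
    using small x by (simp add: graph_eq_iff)
  then show ?thesis
    \<comment> \<open>Both values lie in the carrier of \<open>H\<close>, where applying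
      \<open>?i\<close> changes nothing.\<close>
    using small x f f' by (simp add: hom_in_carrier)
qed

theorem proposition23:
  "faithful_functor (op_cat Grp_cat) (Comonads Set_cat)
     (Phi :: ('v::grothendieck_universe monoid, 'v \<Rightarrow> 'v,
              ('v, 'v \<Rightarrow> 'v) comonad, 'v \<Rightarrow> 'v \<Rightarrow> 'v) cfunctor)"
  unfolding faithful_functor_def
proof (intro conjI ballI inj_onI)
  show "is_functor (op_cat Grp_cat) (Comonads Set_cat) Phi"
    by (rule is_functor_Phi)
next
  fix H G :: "'v monoid" and f f' :: "'v \<Rightarrow> 'v"
  assume "H \<in> Obj (op_cat Grp_cat)" "G \<in> Obj (op_cat Grp_cat)"
    and "f \<in> Hom (op_cat Grp_cat) H G" "f' \<in> Hom (op_cat Grp_cat) H G"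
    and "amap Phi H G f = amap Phi H G f'"
  then show "f = f'"
    \<comment> \<open>Arrows of \<open>Grp_cat\<close> are extensional on the carrier of
      \<open>G\<close>, so agreement there gives equality of the functions.\<close>
    by (auto simp: op_cat_def Grp_cat_def intro: extensionalityI Phi_amap_inject)
qed

end
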